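(* There exist a linear congestion game $\mathcal{G}$ with three players and a symmetric matrix $\Gamma\in\mathbb{R}^{3\times 3}$ with non-negative entries such that the linear congestion game with altruistic social context $(\mathcal{G},\Gamma)$ does not admit any pure Nash equilibrium.
   Context: Linear congestion game: a set of players $[n]=\{1,\dots,n\}$, $n\ge 2$, a finite set $E$ of resources, for each player $i$ a non-empty set $S_i\subseteq 2^E$ of strategies (each strategy is a non-empty subset of $E$), and for each $e\in E$ a latency function $\ell_e(x)=\alpha_e x+\beta_e$ with $\alpha_e,\beta_e\ge 0$. A strategy profile is $S=(s_1,\dots,s_n)$ with $s_i\in S_i$. The congestion of $e$ in $S$ is $n_e(S)=|\{j\in[n]:e\in s_j\}|$, and the cost of player $i$ in the underlying game is $c_i(S)=\sum_{e\in s_i}(\alpha_e n_e(S)+\beta_e)$. For $t\in S_i$, $S_{-i}\diamond t$ denotes the profile obtained from $S$ by replacing $s_i$ with $t$. A linear congestion game with altruistic social context is a pair $(\mathcal{G},\Gamma)$ where $\mathcal{G}$ is a linear congestion game with $n$ players and $\Gamma=(\gamma_{ij})\in\mathbb{R}^{n\times n}$ has non-negative entries; players and strategies are those of $\mathcal{G}$, but the cost of player $i$ in $S$ is $\widehat{c}_i(S)=\sum_{j\in[n]}\gamma_{ij}\,c_j(S)$. A pure Nash equilibrium of $(\mathcal{G},\Gamma)$ is a profile $S$ with $\widehat{c}_i(S)\le\widehat{c}_i(S_{-i}\diamond t)$ for every player $i$ and every $t\in S_i$. (No condition relating $\gamma_{ii}$ to $\gamma_{ij}$ is imposed here; $\gamma_{ii}=0$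 is allowed for some $i$.) *)

theory Defs
  imports "HOL-Analysis.Analysis"
begin

text \<open>
  The \<open>n\<close> players are the elements of a finite index type \<^typ>\<open>'n::finite\<close> with \<open>CARD('n) = n\<close>, so
  that \<open>n \<times> n\<close> matrices are of type \<^typ>\<open>real ^ 'n ^ 'n\<close>.  The values of the coefficient functions
  outside the set of resources are irrelevant.
\<close>

record ('n, 'e) congestion_game =
  resources  :: "'e set"
  strategies :: "'n \<Rightarrow> 'e set set"
  slope      :: "'e \<Rightarrow> real"
  offset     :: "'e \<Rightarrow> real"

definition linear_congestion_game :: "('n::finite, 'e) congestion_game \<Rightarrow> bool" where
  "linear_congestion_game G \<longleftrightarrow>
     CARD('n) \<ge> 2 \<and>
     finite (resources G) \<and>
     (\<forall>i. strategies G i \<noteq> {}) \<and>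
     (\<forall>i. \<forall>t \<in> strategies G i. t \<noteq> {} \<and> t \<subseteq> resources G) \<and>
     (\<forall>e \<in> resources G. slope G e \<ge> 0 \<and> offset G e \<ge> 0)"

definition latency :: "('n, 'e) congestion_game \<Rightarrow> 'e \<Rightarrow> real \<Rightarrow> real" where
  "latency G e x = slope G e * x + offset G e"

definition is_profile :: "('n, 'e) congestion_game \<Rightarrow> ('n \<Rightarrow> 'e set) \<Rightarrow> bool" where
  "is_profile G S \<longleftrightarrow> (\<forall>i. S i \<in> strategies G i)"

definition congestion :: "('n::finite \<Rightarrow> 'e set) \<Rightarrow> 'e \<Rightarrow> nat" where
  "congestion S e = card {j. e \<in> S j}"

definition cost :: "('n::finite, 'e) congestion_game \<Rightarrow> ('n \<Rightarrow> 'e set) \<Rightarrow> 'n \<Rightarrow> real" where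
  "cost G S i = (\<Sum>e \<in> S i. latency G e (real (congestion S e)))"

definition social_context :: "real ^ 'n ^ 'n \<Rightarrow> bool" where
  "social_context \<Gamma> \<longleftrightarrow> (\<forall>i j. \<Gamma> $ i $ j \<ge> 0)"

definition perceived_cost ::
  "('n::finite, 'e) congestion_game \<Rightarrow> real ^ 'n ^ 'n \<Rightarrow> ('n \<Rightarrow> 'e set) \<Rightarrow> 'n \<Rightarrow> real" where
  "perceived_cost G \<Gamma> S i = (\<Sum>j \<in> UNIV. \<Gamma> $ i $ j * cost G S j)"

definition pure_nash_equilibrium ::
  "('n::finite, 'e) congestion_game \<Rightarrow> real ^ 'n ^ 'n \<Rightarrow> ('n \<Rightarrow> 'e set) \<Rightarrow> bool" where
  "pure_nash_equilibrium G \<Gamma> S \<longleftrightarrow>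
     is_profile G S \<and>
     (\<forall>i. \<forall>t \<in> strategies G i. perceived_cost G \<Gamma> S i \<le> perceived_cost G \<Gamma> (S(i := t)) i)"

end

theory Submission
  imports Defs
begin

text \<open>
  Every player picks one of two colours. With \<open>w(t, t')\<close> the total slope on \<open>t \<inter> t'\<close>, player \<open>i\<close>'s
  perceived cost is, up to terms independent of his own strategy \<open>s\<^sub>i\<close>, equal to
  \<open>\<gamma>\<^sub>i\<^sub>i b(s\<^sub>i) + \<Sum>k\<noteq>i. (\<gamma>\<^sub>i\<^sub>i + \<gamma>\<^sub>i\<^sub>k) w(s\<^sub>i, s\<^sub>k)\<close>, where \<open>b(s\<^sub>i)\<close> is the cost of \<open>s\<^sub>i\<close> to a lone player,
  the same for both colours here.
  The pairs 1-2, 1-3 and 2-3 meet exactly when their colours agree, on resources of slope 4, 3, 1.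
  With the context below, player 1 pays mainly for meeting 2 (4 against 3), player 2 pays only for
  meeting 3, and player 3 pays mainly for meeting 1 (3 against \<open>2 \<cdot> 1\<close>).  So in an equilibrium
  1 avoids 2, 2 avoids 3 and 3 avoids 1, which is impossible with two colours.
\<close>

text \<open>Resources 0, 1, 2 serve the pairs 1-2, 1-3, 2-3 in the first colour; 3, 4, 5 serve them
  in the second.\<close>

definition cyclic_game :: "(3, nat) congestion_game" where
  "cyclic_game = \<lparr>
     resources = {0, 1, 2, 3, 4, 5},
     strategies = (\<lambda>i. if i = 1 then {{0, 1}, {3, 4}}
                       else if i = 2 then {{0, 2}, {3, 5}}
                       else {{1, 2}, {4, 5}}),
     slope = (\<lambda>e. if e \<in> {0, 3} then 4 else if e \<in> {1, 4} then 3 else 1),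
     offset = (\<lambda>_. 0)\<rparr>"

text \<open>The zeros at (2, 1) and (2, 2) make player 2 indifferent to meeting player 1.\<close>

definition cyclic_context :: "real ^ 3 ^ 3" where
  "cyclic_context = vector [vector [1, 0, 0], vector [0, 0, 1], vector [0, 1, 1]]"

lemma linear_congestion_game_cyclic_game: "linear_congestion_game cyclic_game"
  by (auto simp: linear_congestion_game_def cyclic_game_def)

lemma social_context_cyclic_context: "social_context cyclic_context"
  by (simp add: social_context_def cyclic_context_def forall_3 vector_3)

lemma transpose_cyclic_context: "transpose cyclic_context = cyclic_context"
  by (simp add: transpose_def cyclic_context_def vec_eq_iff forall_3 vector_3)

lemma perceived_cost_cyclic:
  "perceived_cost G cyclic_context S 1 = cost G S 1"
  "perceived_cost G cyclic_context S 2 = cost G S 3"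
  "perceived_cost G cyclic_context S 3 = cost G S 2 + cost G S 3"
  by (simp_all add: perceived_cost_def cyclic_context_def sum_3 vector_3)

lemma congestion_3:
  fixes S :: "3 \<Rightarrow> 'e set"
  shows "congestion S e = of_bool (e \<in> S 1) + of_bool (e \<in> S 2) + of_bool (e \<in> S 3)"
proof -
  have "congestion S e = (\<Sum>j\<in>UNIV. of_bool (e \<in> S j))"
    by (simp add: congestion_def)
  then show ?thesis
    by (simp add: sum_3)
qed

lemma no_equilibrium_cyclic: "\<not> pure_nash_equilibrium cyclic_game cyclic_context S"
proof
  assume "pure_nash_equilibrium cyclic_game cyclic_context S"
  then have profile: "\<And>i. S i \<in> strategies cyclic_game i"
    and stable: "\<And>i t. t \<in> strategies cyclic_game i \<Longrightarrow>
      perceived_cost cyclic_game cyclic_context S i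
        \<le> perceived_cost cyclic_game cyclic_context (S(i := t)) i"
    by (auto simp: pure_nash_equilibrium_def is_profile_def)
  note stable1 = stable[of "{0, 1}" 1] stable[of "{3, 4}" 1]
  note stable2 = stable[of "{0, 2}" 2] stable[of "{3, 5}" 2]
  note stable3 = stable[of "{1, 2}" 3] stable[of "{4, 5}" 3]
  \<comment> \<open>These decide the tests for the first colour in the cases where a player has the
    second.\<close>
  have distinct_colours:
    "{3, 4} \<noteq> {0, 1 :: nat}" "{3, 5} \<noteq> {0, 2 :: nat}" "{4, 5} \<noteq> {1, 2 :: nat}"
    by (simp_all add: doubleton_eq_iff)
  note unfold_costs = perceived_cost_cyclic cost_def latency_def congestion_3 cyclic_game_def
  have colours: "S 1 = {0, 1} \<or> S 1 = {3, 4}" "S 2 = {0, 2} \<or> S 2 = {3, 5}"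
      "S 3 = {1, 2} \<or> S 3 = {4, 5}"
    using profile[of 1] profile[of 2] profile[of 3] by (simp_all add: cyclic_game_def)
  have "S 1 = {0, 1} \<longleftrightarrow> S 2 \<noteq> {0, 2}"
    using colours distinct_colours stable1 by (elim disjE) (simp_all add: unfold_costs)
  moreover have "S 2 = {0, 2} \<longleftrightarrow> S 3 \<noteq> {1, 2}"
    using colours distinct_colours stable2 by (elim disjE) (simp_all add: unfold_costs)
  moreover have "S 3 = {1, 2} \<longleftrightarrow> S 1 \<noteq> {0, 1}"
    using colours distinct_colours stable3 by (elim disjE) (simp_all add: unfold_costs)
  \<comment> \<open>Three negations around a cycle make \<open>S 1 = {0, 1}\<close> equivalent to
    its own negation.\<close>
  ultimately show False
    by satx
qed

theorem theorem2:
  "\<exists>(G :: (3, nat) congestion_game) (\<Gamma> :: real ^ 3 ^ 3).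
     linear_congestion_game G \<and>
     social_context \<Gamma> \<and>
     transpose \<Gamma> = \<Gamma> \<and>
     \<not> (\<exists>S. pure_nash_equilibrium G \<Gamma> S)"
  using linear_congestion_game_cyclic_game social_context_cyclic_context
    transpose_cyclic_context no_equilibrium_cyclic
  by blast

end
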